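(* Let $L_\tau=(L,\tau)$ be a topoframe. If $L_\tau$ is a $P$-topoframe, then the ring $\mathcal{R}L_\tau$ is an $\aleph_0$-Kasch ring.
   Context: A frame is a complete lattice $L$ (top $\top$, bottom $\bot$) with $a\wedge\bigvee S=\bigvee\{a\wedge s: s\in S\}$ for all $a\in L$, $S\subseteq L$. A frame homomorphism preserves finite meets (including $\top$) and arbitrary joins (including $\bot$). A topoframe $L_\tau$ is a pair $(L,\tau)$ where $L$ is a frame and $\tau$ is a subframe of $L$ all of whose elements are complemented in $L$. A real-continuous function on $L_\tau$ is a frame homomorphism $f:\mathcal{P}(\mathbb{R})\to L$ (where $\mathcal P(\mathbb R)$ is the power set of $\mathbb R$) such that $f(\{x\in\mathbb R: p<x<q\})\in\tau$ for all $p,q\in\mathbb{Q}$. $\mathcal{R}L_\tau$ is the set of all these; it is a commutative (reduced) ring with identity under $(f\diamond g)(X)=\bigvee\{f(Y)\wedge g(Z): Y\diamond Z\subseteq X\}$ for $\diamond\in\{+,\cdot\}$, where $Y\diamond Z=\{y\diamond z: y\in Y, z\in Z\}$, with $(-f)(X)=f(-X)$, and with the constants $\mathbf{r}$ ($r\in\mathbb R$) given by $\mathbf r(X)=\top$ if $r\in X$ and $\bot$ otherwise; $\mathbf 0$ and $\mathbf 1$ are the zero and identity. For $f\in\mathcal{R}L_\tau$, $z(f)=f(\{0\})$. $L_\tau$ is a $P$-topoframe if $z(f)\in\tau$ for all $f\in\mathcal{R}L_\tau$. For an ideal $I$ of a commutative ring $A$, $\mathrm{gen}(I)$ is the least cardinality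 of a generating set of $I$. $I$ is essential in $A$ if $I\cap J\ne(0)$ for every non-zero ideal $J$ of $A$. For a cardinal $\alpha$, $A$ is an $\alpha$-Kasch ring if every proper ideal $I$ of $A$ with $\mathrm{gen}(I)<\alpha$ is non-essential. *)

theory Defs
  imports Complex_Main "HOL-Algebra.Ideal"
begin

unbundle cardinal_syntax

hide_const (open) Lattice.sup Lattice.inf Order.top Order.bottom

text \<open>The library class \<^class>\<open>complete_distrib_lattice\<close> demands complete distributivity, which is
  strictly stronger than the frame law.\<close>

class frame = complete_lattice +
  assumes inf_Sup_frame: "inf a (Sup S) = Sup ((\<lambda>s. inf a s) ` S)"

text \<open>The case \<open>S = {}\<close> below says that \<open>h\<close> preserves the bottom element.\<close>

definition frame_hom :: "('a::complete_lattice \<Rightarrow> 'b::complete_lattice) \<Rightarrow> bool" where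
  "frame_hom h \<longleftrightarrow>
     h top = top \<and> (\<forall>a b. h (inf a b) = inf (h a) (h b)) \<and> (\<forall>S. h (Sup S) = Sup (h ` S))"

definition subframe :: "'a::frame set \<Rightarrow> bool" where
  "subframe T \<longleftrightarrow>
     top \<in> T \<and> (\<forall>a\<in>T. \<forall>b\<in>T. inf a b \<in> T) \<and> (\<forall>S. S \<subseteq> T \<longrightarrow> Sup S \<in> T)"

definition complemented :: "'a::bounded_lattice \<Rightarrow> bool" where
  "complemented a \<longleftrightarrow> (\<exists>b. inf a b = bot \<and> sup a b = top)"

definition topoframe :: "'a::frame set \<Rightarrow> bool" where
  "topoframe \<tau> \<longleftrightarrow> subframe \<tau> \<and> (\<forall>a\<in>\<tau>. complemented a)"

definition real_continuous :: "'a::frame set \<Rightarrow> (real set \<Rightarrow> 'a) \<Rightarrow> bool" where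
  "real_continuous \<tau> f \<longleftrightarrow>
     frame_hom f \<and> (\<forall>p q :: rat. f {x. of_rat p < x \<and> x < of_rat q} \<in> \<tau>)"

definition lift_op ::
    "(real \<Rightarrow> real \<Rightarrow> real) \<Rightarrow> (real set \<Rightarrow> 'a::frame) \<Rightarrow> (real set \<Rightarrow> 'a) \<Rightarrow> real set \<Rightarrow> 'a" where
  "lift_op d f g X = Sup {inf (f Y) (g Z) | Y Z. {d y z | y z. y \<in> Y \<and> z \<in> Z} \<subseteq> X}"

definition const_fun :: "real \<Rightarrow> real set \<Rightarrow> 'a::frame" where
  "const_fun r X = (if r \<in> X then top else bot)"

definition RL :: "'a::frame set \<Rightarrow> (real set \<Rightarrow> 'a) ring" where
  "RL \<tau> = \<lparr>carrier = {f. real_continuous \<tau> f},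
           mult = lift_op (*), one = const_fun 1,
           zero = const_fun 0, add = lift_op (+)\<rparr>"

definition zero_elt :: "(real set \<Rightarrow> 'a::frame) \<Rightarrow> 'a" where
  "zero_elt f = f {0}"

definition P_topoframe :: "'a::frame set \<Rightarrow> bool" where
  "P_topoframe \<tau> \<longleftrightarrow> topoframe \<tau> \<and> (\<forall>f \<in> carrier (RL \<tau>). zero_elt f \<in> \<tau>)"

text \<open>As usual in the library, cardinals are represented by minimal well-orders, compared by
  \<open><o\<close> and \<open>\<le>o\<close>; \<^const>\<open>natLeq\<close> is the cardinal aleph-null.\<close>

definition generates :: "('a, 'b) ring_scheme \<Rightarrow> 'a set \<Rightarrow> 'a set \<Rightarrow> bool" where
  "generates R S I \<longleftrightarrow> S \<subseteq> carrier R \<and> Idl\<^bsub>R\<^esub> S = I"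

definition gen :: "('a, 'b) ring_scheme \<Rightarrow> 'a set \<Rightarrow> 'a rel" where
  "gen R I = (SOME r. (\<exists>S. generates R S I \<and> r = |S| ) \<and> (\<forall>T. generates R T I \<longrightarrow> r \<le>o |T| ))"

lemma gen_least:
  assumes "ideal I R"
  shows "(\<exists>S. generates R S I \<and> gen R I = |S| ) \<and> (\<forall>T. generates R T I \<longrightarrow> gen R I \<le>o |T| )"
proof -
  interpret ideal I R by fact
  have "Idl\<^bsub>R\<^esub> I = I"
    using assms by (auto simp: genideal_def)
  then have "generates R I I"
    by (simp add: generates_def a_subset)
  then have "\<exists>r \<in> {|S| | S. generates R S I}. \<forall>r' \<in> {|S| | S. generates R S I}. r \<le>o r'"
    by (intro exists_minim_Card_order) (auto simp: card_of_Card_order)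
  then have "\<exists>r. (\<exists>S. generates R S I \<and> r = |S| ) \<and> (\<forall>T. generates R T I \<longrightarrow> r \<le>o |T| )"
    by auto
  then show ?thesis
    unfolding gen_def by (rule someI_ex)
qed

definition essential_ideal :: "('a, 'b) ring_scheme \<Rightarrow> 'a set \<Rightarrow> bool" where
  "essential_ideal R I \<longleftrightarrow> ideal I R \<and> (\<forall>J. ideal J R \<and> J \<noteq> {\<zero>\<^bsub>R\<^esub>} \<longrightarrow> I \<inter> J \<noteq> {\<zero>\<^bsub>R\<^esub>})"

definition kasch :: "'c rel \<Rightarrow> ('a, 'b) ring_scheme \<Rightarrow> bool" where
  "kasch \<alpha> R \<longleftrightarrow> cring R \<and>
     (\<forall>I. ideal I R \<and> I \<noteq> carrier R \<and> gen R I <o \<alpha> \<longrightarrow> \<not> essential_ideal R I)"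

end

theory Submission
  imports Defs
begin

text \<open>
  A frame homomorphism \<open>f\<close> on the power set of the reals is the same thing as a partition of the
  top element into the pieces \<open>f {x}\<close>; on the piece \<open>f {x}\<close> the function \<open>f\<close> is to be thought of as
  having the constant value \<open>x\<close>.  Given several such functions, the meets of their pieces form a
  common refinement on each member of which all of them are constant, and there \<open>lift_op d f g\<close> takes
  the value \<open>d y z\<close> if \<open>f\<close> and \<open>g\<close> take the values \<open>y\<close> and \<open>z\<close>.  Two homomorphisms that take equal
  values on every member of a cover are equal (\<open>frame_hom_eqI\<close>), so every identity between real
  numbers becomes an identity between real-continuous functions.  This yields the ring laws, once
  continuity of the real operations is used to see that the operations stay within the
  real-continuous functions.

  In a P-topoframe the ring is moreover von Neumann regular (\<open>RL_regular\<close>): composing \<open>f\<close> with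
  \<open>x \<mapsto> 1/x\<close>, where \<open>1/0 = 0\<close>, gives a quasi-inverse \<open>u\<close> with \<open>f\<^sup>2 u = f\<close>.  The only discontinuity of
  this map is at \<open>0\<close>, and this is harmless because \<open>f {0}\<close> belongs to \<open>\<tau>\<close>.

  The rest is algebra (\<open>regular_kasch\<close>).  In a commutative von Neumann regular ring, a finitely
  generated ideal \<open>I\<close> contains an element \<open>e\<close> that acts on \<open>I\<close> as an identity.  If \<open>I\<close> is proper,
  then \<open>1 - e\<close> is non-zero, and the ideal that it generates meets \<open>I\<close> only in zero.
\<close>

section \<open>Frame homomorphisms as partitions\<close>

lemma Sup_inf_Sup_frame:
  fixes A B :: "'a::frame set"
  shows "inf (Sup A) (Sup B) = Sup {inf a b | a b. a \<in> A \<and> b \<in> B}"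
proof -
  have "inf (Sup A) (Sup B) = Sup ((\<lambda>b. inf (Sup A) b) ` B)"
    by (rule inf_Sup_frame)
  also have "\<dots> = Sup ((\<lambda>b. Sup ((\<lambda>a. inf b a) ` A)) ` B)"
    by (simp add: inf_Sup_frame[symmetric] inf_commute)
  also have "\<dots> = Sup {inf a b | a b. a \<in> A \<and> b \<in> B}"
  proof (rule order.antisym)
    have "inf b a \<le> Sup {inf a b | a b. a \<in> A \<and> b \<in> B}" if "a \<in> A" "b \<in> B" for a b
      using that by (intro Sup_upper) (use inf_commute in blast)
    then show "Sup ((\<lambda>b. Sup ((\<lambda>a. inf b a) ` A)) ` B) \<le> Sup {inf a b | a b. a \<in> A \<and> b \<in> B}"
      by (auto intro!: Sup_least)
    show "Sup {inf a b | a b. a \<in> A \<and> b \<in> B} \<le> Sup ((\<lambda>b. Sup ((\<lambda>a. inf b a) ` A)) ` B)"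
    proof (rule Sup_least, safe)
      fix a b assume "a \<in> A" "b \<in> B"
      then have "inf a b \<le> Sup ((\<lambda>a. inf b a) ` A)"
        by (auto intro: Sup_upper simp: inf_commute)
      also have "\<dots> \<le> Sup ((\<lambda>b. Sup ((\<lambda>a. inf b a) ` A)) ` B)"
        using \<open>b \<in> B\<close> by (auto intro: Sup_upper)
      finally show "inf a b \<le> Sup ((\<lambda>b. Sup ((\<lambda>a. inf b a) ` A)) ` B)" .
    qed
  qed
  finally show ?thesis .
qed

lemma frame_hom_top: "frame_hom h \<Longrightarrow> h top = top"
  and frame_hom_inf: "frame_hom h \<Longrightarrow> h (inf a b) = inf (h a) (h b)"
  and frame_hom_Sup: "frame_hom h \<Longrightarrow> h (Sup S) = Sup (h ` S)"
  by (simp_all add: frame_hom_def)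

lemma frame_hom_bot: "frame_hom h \<Longrightarrow> h bot = bot"
  using frame_hom_Sup[of h "{}"] by simp

lemma frame_hom_mono: "frame_hom h \<Longrightarrow> a \<le> b \<Longrightarrow> h a \<le> h b"
  by (metis frame_hom_inf inf.absorb_iff1)

lemma frame_hom_points:
  assumes "frame_hom f"
  shows "f X = Sup ((\<lambda>x. f {x}) ` X)"
  using frame_hom_Sup[OF assms, of "(\<lambda>x. {x}) ` X"] by (simp add: image_image)

lemma frame_hom_disjoint:
  assumes "frame_hom f" "X \<inter> Y = {}"
  shows "inf (f X) (f Y) = bot"
  using frame_hom_inf[OF assms(1), of X Y] frame_hom_bot[OF assms(1)] assms(2) by simp

text \<open>Disjointness of the members removes the mixed terms from the meet of two joins, which is why
  meets are preserved.  Different members may carry the same label: for a sum or a product the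
  members are indexed by pairs of reals.\<close>

lemma frame_hom_partition:
  fixes p :: "'i \<Rightarrow> 'a::frame" and v :: "'i \<Rightarrow> 'b"
  assumes top: "Sup (range p) = top"
    and disj: "\<And>i j. i \<noteq> j \<Longrightarrow> inf (p i) (p j) = bot"
  shows "frame_hom (\<lambda>X. Sup {p i | i. v i \<in> X})"
  unfolding frame_hom_def
proof (intro conjI allI)
  show "Sup {p i | i. v i \<in> top} = top"
    using top by (simp add: full_SetCompr_eq)
next
  fix X Y :: "'b set"
  have "inf (Sup {p i | i. v i \<in> X}) (Sup {p i | i. v i \<in> Y})
      = Sup {inf a b | a b. a \<in> {p i | i. v i \<in> X} \<and> b \<in> {p i | i. v i \<in> Y}}"
    by (rule Sup_inf_Sup_frame)
  also have "\<dots> \<le> Sup {p i | i. v i \<in> inf X Y}"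
  proof (rule Sup_least, safe)
    fix i j assume "v i \<in> X" "v j \<in> Y"
    then show "inf (p i) (p j) \<le> Sup {p i | i. v i \<in> inf X Y}"
      by (cases "i = j") (auto intro: Sup_upper simp: disj)
  qed
  finally show "Sup {p i | i. v i \<in> inf X Y}
      = inf (Sup {p i | i. v i \<in> X}) (Sup {p i | i. v i \<in> Y})"
    by (intro order.antisym) (auto intro!: Sup_subset_mono)
next
  fix S :: "'b set set"
  show "Sup {p i | i. v i \<in> Sup S} = Sup ((\<lambda>X. Sup {p i | i. v i \<in> X}) ` S)"
  proof (rule order.antisym)
    show "Sup {p i | i. v i \<in> Sup S} \<le> Sup ((\<lambda>X. Sup {p i | i. v i \<in> X}) ` S)"
    proof (rule Sup_least, safe)
      fix i X assume "v i \<in> X" "X \<in> S"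
      have "p i \<le> Sup {p i | i. v i \<in> X}"
        using \<open>v i \<in> X\<close> by (auto intro: Sup_upper)
      also have "\<dots> \<le> Sup ((\<lambda>X. Sup {p i | i. v i \<in> X}) ` S)"
        using \<open>X \<in> S\<close> by (auto intro: Sup_upper)
      finally show "p i \<le> Sup ((\<lambda>X. Sup {p i | i. v i \<in> X}) ` S)" .
    qed
    show "Sup ((\<lambda>X. Sup {p i | i. v i \<in> X}) ` S) \<le> Sup {p i | i. v i \<in> Sup S}"
      by (auto intro!: Sup_least intro: Sup_upper)
  qed
qed

text \<open>On a member \<open>a\<close> of the cover where \<open>F\<close> and \<open>G\<close> both take the value \<open>x\<close>, the meet of \<open>a\<close> with
  \<open>F X\<close> lies below \<open>G X\<close> if \<open>x \<in> X\<close> and is the bottom element otherwise.\<close>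

lemma frame_hom_le:
  fixes F G :: "'b set \<Rightarrow> 'a::frame"
  assumes F: "frame_hom F" and G: "frame_hom G" and C: "Sup C = top"
    and eq: "\<And>a. a \<in> C \<Longrightarrow> \<exists>x. a \<le> F {x} \<and> a \<le> G {x}"
  shows "F X \<le> G X"
proof -
  have "F X = inf (F X) (Sup C)" by (simp add: C)
  also have "\<dots> = Sup ((\<lambda>a. inf (F X) a) ` C)" by (rule inf_Sup_frame)
  also have "\<dots> \<le> G X"
  proof (rule Sup_least, safe)
    fix a assume "a \<in> C"
    then obtain x where x: "a \<le> F {x}" "a \<le> G {x}" using eq by blast
    show "inf (F X) a \<le> G X"
    proof (cases "x \<in> X")
      case True
      then have "G {x} \<le> G X" by (intro frame_hom_mono[OF G]) auto
      then show ?thesis using x(2) by (meson inf.coboundedI2 order_trans)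
    next
      case False
      have "inf (F X) a \<le> inf (F X) (F {x})" using x(1) by (rule inf_mono[OF order_refl])
      also have "\<dots> = bot" using False by (intro frame_hom_disjoint[OF F]) auto
      finally show ?thesis by (simp add: bot_unique)
    qed
  qed
  finally show ?thesis .
qed

lemma frame_hom_eqI:
  fixes F G :: "'b set \<Rightarrow> 'a::frame"
  assumes "frame_hom F" "frame_hom G" "Sup C = top"
    and "\<And>a. a \<in> C \<Longrightarrow> \<exists>x. a \<le> F {x} \<and> a \<le> G {x}"
  shows "F = G"
proof
  fix X show "F X = G X"
    using frame_hom_le[of F G C X] frame_hom_le[of G F C X] assms by (metis order.antisym)
qed

lemma Sup_pieces_pair:
  fixes f :: "'b set \<Rightarrow> 'a::frame" and g :: "'c set \<Rightarrow> 'a"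
  assumes "frame_hom f" "frame_hom g"
  shows "inf (f Y) (g Z) = Sup {inf (f {y}) (g {z}) | y z. y \<in> Y \<and> z \<in> Z}"
proof -
  have "inf (f Y) (g Z) = inf (Sup ((\<lambda>y. f {y}) ` Y)) (Sup ((\<lambda>z. g {z}) ` Z))"
    using frame_hom_points[OF assms(1)] frame_hom_points[OF assms(2)] by metis
  also have "\<dots> = Sup {inf (f {y}) (g {z}) | y z. y \<in> Y \<and> z \<in> Z}"
    unfolding Sup_inf_Sup_frame by (rule arg_cong[where f = Sup]) auto
  finally show ?thesis .
qed

text \<open>The working form of the comparison principle: the cover consists of the meets of the pieces of
  three given homomorphisms, as needed for laws in at most three variables.\<close>

lemma frame_hom_eqI_pieces:
  fixes F G f g h :: "real set \<Rightarrow> 'a::frame"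
  assumes F: "frame_hom F" and G: "frame_hom G"
    and f: "frame_hom f" and g: "frame_hom g" and h: "frame_hom h"
    and eq: "\<And>a x y z. a \<le> f {x} \<Longrightarrow> a \<le> g {y} \<Longrightarrow> a \<le> h {z} \<Longrightarrow> \<exists>w. a \<le> F {w} \<and> a \<le> G {w}"
  shows "F = G"
proof (rule frame_hom_eqI[OF F G])
  let ?B = "{inf (f {x}) (g {y}) | x y. x \<in> UNIV \<and> y \<in> UNIV}"
  let ?C = "{inf a b | a b. a \<in> ?B \<and> b \<in> range (\<lambda>z. h {z})}"
  have "Sup ?C = inf (inf (f top) (g top)) (h top)"
    unfolding Sup_inf_Sup_frame[symmetric]
    using Sup_pieces_pair[OF f g, of UNIV UNIV] frame_hom_points[OF h, of UNIV] by simp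
  then show "Sup ?C = top"
    using f g h by (simp add: frame_hom_top)
  fix a assume "a \<in> ?C"
  then obtain x y z where "a = inf (inf (f {x}) (g {y})) (h {z})" by auto
  then show "\<exists>w. a \<le> F {w} \<and> a \<le> G {w}"
    by (intro eq[of a x y z]) (auto intro: le_infI1)
qed

section \<open>Operations on real-continuous functions\<close>

lemma lift_op_points:
  fixes f g :: "real set \<Rightarrow> 'a::frame"
  assumes "frame_hom f" "frame_hom g"
  shows "lift_op d f g X = Sup {inf (f {y}) (g {z}) | y z. d y z \<in> X}"
proof (rule order.antisym)
  show "lift_op d f g X \<le> Sup {inf (f {y}) (g {z}) | y z. d y z \<in> X}"
    unfolding lift_op_def
  proof (rule Sup_least, safe)
    fix Y Z assume "{d y z | y z. y \<in> Y \<and> z \<in> Z} \<subseteq> X"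
    then show "inf (f Y) (g Z) \<le> Sup {inf (f {y}) (g {z}) | y z. d y z \<in> X}"
      by (subst Sup_pieces_pair[OF assms]) (rule Sup_subset_mono, blast)
  qed
  show "Sup {inf (f {y}) (g {z}) | y z. d y z \<in> X} \<le> lift_op d f g X"
    unfolding lift_op_def by (rule Sup_subset_mono) auto
qed

lemma lift_op_value:
  fixes f g :: "real set \<Rightarrow> 'a::frame"
  assumes "a \<le> f {y}" "a \<le> g {z}"
  shows "a \<le> lift_op d f g {d y z}"
proof -
  have "inf (f {y}) (g {z}) \<le> lift_op d f g {d y z}"
    unfolding lift_op_def by (rule Sup_upper) blast
  then show ?thesis using assms by (meson le_inf_iff order_trans)
qed

lemma frame_hom_lift_op:
  fixes f g :: "real set \<Rightarrow> 'a::frame"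
  assumes f: "frame_hom f" and g: "frame_hom g"
  shows "frame_hom (lift_op d f g)"
proof -
  define p where "p = (\<lambda>(y, z). inf (f {y}) (g {z}))"
  have "frame_hom (\<lambda>X. Sup {p i | i. (case i of (y, z) \<Rightarrow> d y z) \<in> X})"
  proof (rule frame_hom_partition)
    have "range p = {inf (f {y}) (g {z}) | y z. y \<in> UNIV \<and> z \<in> UNIV}"
      by (auto simp: p_def)
    then show "Sup (range p) = top"
      using Sup_pieces_pair[OF f g, of UNIV UNIV] f g by (simp add: frame_hom_top)
    fix i j :: "real \<times> real" assume "i \<noteq> j"
    obtain y z y' z' where ij: "i = (y, z)" "j = (y', z')" by (metis surj_pair)
    have "inf (p i) (p j) = inf (inf (f {y}) (f {y'})) (inf (g {z}) (g {z'}))"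
      by (simp add: p_def ij inf_aci)
    moreover have "inf (f {y}) (f {y'}) = bot \<or> inf (g {z}) (g {z'}) = bot"
      using \<open>i \<noteq> j\<close> frame_hom_disjoint[OF f, of "{y}" "{y'}"]
        frame_hom_disjoint[OF g, of "{z}" "{z'}"] by (auto simp: ij)
    ultimately show "inf (p i) (p j) = bot" by auto
  qed
  moreover have "(\<lambda>X. Sup {p i | i. (case i of (y, z) \<Rightarrow> d y z) \<in> X}) = lift_op d f g"
    by (auto simp: fun_eq_iff lift_op_points[OF f g] p_def intro!: arg_cong[where f = Sup])
  ultimately show ?thesis by simp
qed

lemma frame_hom_vimage: "frame_hom f \<Longrightarrow> frame_hom (\<lambda>X. f (\<phi> -` X))"
  unfolding frame_hom_def
proof (intro conjI allI)
  assume f: "f top = top \<and> (\<forall>a b. f (inf a b) = inf (f a) (f b)) \<and> (\<forall>S. f (Sup S) = Sup (f ` S))"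
  show "f (\<phi> -` top) = top"
    using f by simp
  show "f (\<phi> -` inf X Y) = inf (f (\<phi> -` X)) (f (\<phi> -` Y))" for X Y
    using f by simp
  have "\<phi> -` Sup S = Sup ((-`) \<phi> ` S)" for S
    by auto
  then show "f (\<phi> -` Sup S) = Sup ((\<lambda>X. f (\<phi> -` X)) ` S)" for S
    using f by (metis image_image)
qed

lemma frame_hom_const_fun: "frame_hom (const_fun r :: real set \<Rightarrow> 'b::frame)"
proof -
  have "frame_hom (\<lambda>X. Sup {top :: 'b | u :: unit. r \<in> X})"
    by (rule frame_hom_partition) auto
  moreover have "(\<lambda>X. Sup {top :: 'b | u :: unit. r \<in> X}) = const_fun r"
    by (simp add: fun_eq_iff const_fun_def)
  ultimately show ?thesis by simp
qed

lemma subframe_bot: "subframe \<tau> \<Longrightarrow> bot \<in> \<tau>"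
  unfolding subframe_def by (metis Sup_empty empty_subsetI)

lemma subframe_sup: "subframe \<tau> \<Longrightarrow> a \<in> \<tau> \<Longrightarrow> b \<in> \<tau> \<Longrightarrow> sup a b \<in> \<tau>"
  unfolding subframe_def
  by (metis Sup_insert Sup_empty sup_bot_right empty_subsetI insert_subset)

lemma open_real_eq_Union_rat_intervals:
  fixes U :: "real set"
  assumes "open U"
  shows "U = \<Union>{S. S \<subseteq> U \<and> (\<exists>p q :: rat. S = {x. of_rat p < x \<and> x < of_rat q})}"
proof (intro subset_antisym subsetI)
  fix x assume "x \<in> U"
  then obtain e where e: "e > 0" "\<And>y. dist y x < e \<Longrightarrow> y \<in> U"
    using assms by (metis open_dist)
  obtain p :: rat where p: "x - e < of_rat p" "of_rat p < x"
    using of_rat_dense[of "x - e" x] e(1) by auto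
  obtain q :: rat where q: "x < of_rat q" "of_rat q < x + e"
    using of_rat_dense[of x "x + e"] e(1) by auto
  have "{x. of_rat p < x \<and> x < of_rat q} \<subseteq> U"
    using p q by (auto intro!: e(2) simp: dist_real_def)
  then show "x \<in> \<Union>{S. S \<subseteq> U \<and> (\<exists>p q :: rat. S = {x. of_rat p < x \<and> x < of_rat q})}"
    using p q by (intro UnionI[of "{x. of_rat p < x \<and> x < of_rat q}"]) blast+
qed auto

lemma real_continuous_iff_open:
  assumes "subframe \<tau>"
  shows "real_continuous \<tau> f \<longleftrightarrow> frame_hom f \<and> (\<forall>U. open U \<longrightarrow> f U \<in> \<tau>)"
proof safe
  assume f: "real_continuous \<tau> f"
  then show hom: "frame_hom f" by (simp add: real_continuous_def)
  fix U :: "real set" assume "open U"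
  let ?S = "{S. S \<subseteq> U \<and> (\<exists>p q :: rat. S = {x. of_rat p < x \<and> x < of_rat q})}"
  have "f U = Sup (f ` ?S)"
    using frame_hom_Sup[OF hom, of ?S] open_real_eq_Union_rat_intervals[OF \<open>open U\<close>] by simp
  moreover have "f ` ?S \<subseteq> \<tau>"
    using f by (auto simp: real_continuous_def)
  ultimately show "f U \<in> \<tau>"
    using assms by (simp add: subframe_def)
next
  assume f: "frame_hom f" "\<forall>U. open U \<longrightarrow> f U \<in> \<tau>"
  have "open {x. of_rat p < x \<and> x < (of_rat q :: real)}" for p q
    by (intro open_Collect_conj open_Collect_less continuous_intros)
  then show "real_continuous \<tau> f"
    using f by (simp add: real_continuous_def)
qed

text \<open>The preimage of an open set under \<open>d\<close> is a union of open boxes \<open>A \<times> B\<close>, and such a box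
  contributes \<open>f A \<sqinter> g B \<in> \<tau>\<close>.\<close>

lemma real_continuous_lift_op:
  assumes \<tau>: "subframe \<tau>" and f: "real_continuous \<tau> f" and g: "real_continuous \<tau> g"
    and d: "continuous_on UNIV (\<lambda>(y, z). d y z)"
  shows "real_continuous \<tau> (lift_op d f g)"
  unfolding real_continuous_iff_open[OF \<tau>]
proof (intro conjI allI impI)
  have hom: "frame_hom f" "frame_hom g"
    and mem: "\<And>U. open U \<Longrightarrow> f U \<in> \<tau>" "\<And>U. open U \<Longrightarrow> g U \<in> \<tau>"
    using f g by (auto simp: real_continuous_iff_open[OF \<tau>])
  show "frame_hom (lift_op d f g)"
    using hom by (rule frame_hom_lift_op)
  fix U :: "real set" assume "open U"
  define W where "W = (\<lambda>(y, z). d y z) -` U"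
  have W: "open W"
    unfolding W_def using d \<open>open U\<close> by (metis open_vimage)
  define T where "T = {inf (f A) (g B) | A B. open A \<and> open B \<and> A \<times> B \<subseteq> W}"
  have "lift_op d f g U = Sup T"
  proof (rule order.antisym)
    show "lift_op d f g U \<le> Sup T"
      unfolding lift_op_points[OF hom]
    proof (rule Sup_least, safe)
      fix y z assume "d y z \<in> U"
      then have "(y, z) \<in> W" by (simp add: W_def)
      then obtain A B where AB: "open A" "open B" "(y, z) \<in> A \<times> B" "A \<times> B \<subseteq> W"
        using open_prod_elim[OF W] by blast
      then have "inf (f {y}) (g {z}) \<le> inf (f A) (g B)"
        by (intro inf_mono frame_hom_mono[OF hom(1)] frame_hom_mono[OF hom(2)]) auto
      also have "\<dots> \<le> Sup T"
        using AB by (intro Sup_upper) (auto simp: T_def)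
      finally show "inf (f {y}) (g {z}) \<le> Sup T" .
    qed
    show "Sup T \<le> lift_op d f g U"
      unfolding lift_op_def T_def W_def by (rule Sup_subset_mono) fast
  qed
  moreover have "T \<subseteq> \<tau>"
    using mem \<tau> by (auto simp: T_def subframe_def)
  ultimately show "lift_op d f g U \<in> \<tau>"
    using \<tau> by (simp add: subframe_def)
qed

lemma real_continuous_const_fun: "subframe \<tau> \<Longrightarrow> real_continuous \<tau> (const_fun r)"
  by (auto simp: real_continuous_iff_open frame_hom_const_fun const_fun_def subframe_bot)
    (simp add: subframe_def)

lemma const_fun_value: "a \<le> const_fun r {r}"
  by (simp add: const_fun_def)

section \<open>The ring of real-continuous functions\<close>

text \<open>In each law below the witness is the common value of both sides on a piece where the functions
  involved take the values \<open>x\<close>, \<open>y\<close> and \<open>z\<close>.\<close>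

lemma RL_cring:
  assumes \<tau>: "subframe \<tau>"
  shows "cring (RL \<tau>)"
proof (rule cringI)
  have hom: "frame_hom f" if "f \<in> carrier (RL \<tau>)" for f
    using that by (simp add: RL_def real_continuous_def)
  have const: "const_fun r \<in> carrier (RL \<tau>)" for r
    using real_continuous_const_fun[OF \<tau>] by (simp add: RL_def)
  have add: "f \<oplus>\<^bsub>RL \<tau>\<^esub> g = lift_op (+) f g" and mult: "f \<otimes>\<^bsub>RL \<tau>\<^esub> g = lift_op (*) f g"
    and zero: "\<zero>\<^bsub>RL \<tau>\<^esub> = const_fun 0" and one: "\<one>\<^bsub>RL \<tau>\<^esub> = const_fun 1" for f g
    by (simp_all add: RL_def)
  have addc: "lift_op (+) f g \<in> carrier (RL \<tau>)"
    if "f \<in> carrier (RL \<tau>)" "g \<in> carrier (RL \<tau>)" for f g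
    using that by (auto simp: RL_def split_def intro!: real_continuous_lift_op \<tau> continuous_intros)
  have multc: "lift_op (*) f g \<in> carrier (RL \<tau>)"
    if "f \<in> carrier (RL \<tau>)" "g \<in> carrier (RL \<tau>)" for f g
    using that by (auto simp: RL_def split_def intro!: real_continuous_lift_op \<tau> continuous_intros)
  show "abelian_group (RL \<tau>)"
  proof (rule abelian_groupI; unfold add zero)
    fix f g h assume f: "f \<in> carrier (RL \<tau>)" and g: "g \<in> carrier (RL \<tau>)" and h: "h \<in> carrier (RL \<tau>)"
    show "lift_op (+) (lift_op (+) f g) h = lift_op (+) f (lift_op (+) g h)"
    proof (rule frame_hom_eqI_pieces[of _ _ f g h], goal_cases)
      case (6 a x y z)
      then show ?case
        using lift_op_value[of a "lift_op (+) f g" "x + y" h z "(+)"]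
          lift_op_value[of a f x "lift_op (+) g h" "y + z" "(+)"]
        by (intro exI[of _ "x + y + z"]) (simp add: lift_op_value add.assoc)
    qed (use f g h in \<open>auto intro!: hom addc multc\<close>)
  next
    fix f g assume f: "f \<in> carrier (RL \<tau>)" and g: "g \<in> carrier (RL \<tau>)"
    show "lift_op (+) f g = lift_op (+) g f"
    proof (rule frame_hom_eqI_pieces[of _ _ f g g], goal_cases)
      case (6 a x y z)
      then show ?case
        using lift_op_value[of a f x g y "(+)"] lift_op_value[of a g y f x "(+)"]
        by (intro exI[of _ "x + y"]) (simp add: add.commute)
    qed (use f g in \<open>auto intro!: hom addc multc\<close>)
  next
    fix f assume f: "f \<in> carrier (RL \<tau>)"
    show "lift_op (+) (const_fun 0) f = f"
    proof (rule frame_hom_eqI_pieces[of _ _ f f f], goal_cases)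
      case (6 a x y z)
      then show ?case
        using lift_op_value[of a "const_fun 0" 0 f x "(+)"]
        by (intro exI[of _ x]) (simp add: const_fun_value)
    qed (use f in \<open>auto intro!: hom addc multc const\<close>)
    define g where "g = (\<lambda>X. f (uminus -` X))"
    have "open (uminus -` U)" if "open U" for U :: "real set"
      using that by (rule open_vimage) (rule continuous_intros)+
    then have "real_continuous \<tau> g"
      using f frame_hom_vimage[of f uminus]
      by (simp add: g_def RL_def real_continuous_iff_open[OF \<tau>])
    then have g: "g \<in> carrier (RL \<tau>)"
      by (simp add: RL_def)
    have "lift_op (+) g f = const_fun 0"
    proof (rule frame_hom_eqI_pieces[of _ _ f f f], goal_cases)
      case (6 a x y z)
      have "uminus -` {- x} = {x}" by auto
      with 6 show ?case
        using lift_op_value[of a g "- x" f x "(+)"]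
        by (intro exI[of _ 0]) (simp add: const_fun_value g_def)
    qed (use f g in \<open>auto intro!: hom addc multc const\<close>)
    with g show "\<exists>g\<in>carrier (RL \<tau>). lift_op (+) g f = const_fun 0" by blast
  qed (auto intro: addc const)
  show "comm_monoid (RL \<tau>)"
  proof (rule comm_monoidI; unfold mult one)
    fix f g h assume f: "f \<in> carrier (RL \<tau>)" and g: "g \<in> carrier (RL \<tau>)" and h: "h \<in> carrier (RL \<tau>)"
    show "lift_op (*) (lift_op (*) f g) h = lift_op (*) f (lift_op (*) g h)"
    proof (rule frame_hom_eqI_pieces[of _ _ f g h], goal_cases)
      case (6 a x y z)
      then show ?case
        using lift_op_value[of a "lift_op (*) f g" "x * y" h z "(*)"]
          lift_op_value[of a f x "lift_op (*) g h" "y * z" "(*)"]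
        by (intro exI[of _ "x * y * z"]) (simp add: lift_op_value mult.assoc)
    qed (use f g h in \<open>auto intro!: hom addc multc\<close>)
  next
    fix f g assume f: "f \<in> carrier (RL \<tau>)" and g: "g \<in> carrier (RL \<tau>)"
    show "lift_op (*) f g = lift_op (*) g f"
    proof (rule frame_hom_eqI_pieces[of _ _ f g g], goal_cases)
      case (6 a x y z)
      then show ?case
        using lift_op_value[of a f x g y "(*)"] lift_op_value[of a g y f x "(*)"]
        by (intro exI[of _ "x * y"]) (simp add: mult.commute)
    qed (use f g in \<open>auto intro!: hom addc multc\<close>)
  next
    fix f assume f: "f \<in> carrier (RL \<tau>)"
    show "lift_op (*) (const_fun 1) f = f"
    proof (rule frame_hom_eqI_pieces[of _ _ f f f], goal_cases)
      case (6 a x y z)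
      then show ?case
        using lift_op_value[of a "const_fun 1" 1 f x "(*)"]
        by (intro exI[of _ x]) (simp add: const_fun_value)
    qed (use f in \<open>auto intro!: hom addc multc const\<close>)
  qed (auto intro: multc const)
  fix f g h assume f: "f \<in> carrier (RL \<tau>)" and g: "g \<in> carrier (RL \<tau>)" and h: "h \<in> carrier (RL \<tau>)"
  show "(f \<oplus>\<^bsub>RL \<tau>\<^esub> g) \<otimes>\<^bsub>RL \<tau>\<^esub> h = f \<otimes>\<^bsub>RL \<tau>\<^esub> h \<oplus>\<^bsub>RL \<tau>\<^esub> g \<otimes>\<^bsub>RL \<tau>\<^esub> h"
    unfolding add mult
  proof (rule frame_hom_eqI_pieces[of _ _ f g h], goal_cases)
    case (6 a x y z)
    then show ?case
      using lift_op_value[of a "lift_op (+) f g" "x + y" h z "(*)"]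
        lift_op_value[of a "lift_op (*) f h" "x * z" "lift_op (*) g h" "y * z" "(+)"]
      by (intro exI[of _ "(x + y) * z"]) (simp add: lift_op_value distrib_right)
  qed (use f g h in \<open>auto intro!: hom addc multc\<close>)
qed

text \<open>The quasi-inverse is \<open>f\<close> followed by inversion with \<open>1/0 = 0\<close>, for which \<open>x\<^sup>2 (1/x) = x\<close> holds
  for every real \<open>x\<close>.  It is real-continuous because the preimage of an open set is open up to the
  point \<open>0\<close>, and both open sets and \<open>{0}\<close> are sent into \<open>\<tau>\<close>.\<close>

lemma RL_regular:
  assumes "P_topoframe \<tau>" and f: "f \<in> carrier (RL \<tau>)"
  shows "\<exists>u\<in>carrier (RL \<tau>). (f \<otimes>\<^bsub>RL \<tau>\<^esub> f) \<otimes>\<^bsub>RL \<tau>\<^esub> u = f"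
proof
  have \<tau>: "subframe \<tau>" and z: "f {0} \<in> \<tau>"
    using assms by (auto simp: P_topoframe_def topoframe_def zero_elt_def)
  have hom: "frame_hom f" and mem: "\<And>U. open U \<Longrightarrow> f U \<in> \<tau>"
    using f by (auto simp: RL_def real_continuous_iff_open[OF \<tau>])
  define u where "u = (\<lambda>X. f (inverse -` X))"
  have homu: "frame_hom u"
    unfolding u_def by (rule frame_hom_vimage[OF hom])
  have "u U \<in> \<tau>" if "open U" for U
  proof -
    \<comment> \<open>Away from its discontinuity \<open>0\<close>, the preimage of \<open>U\<close> under inversion is open.\<close>
    let ?V = "inverse -` U \<inter> (- {0})"
    have "open ?V"
      using that
      by (intro continuous_on_open_vimage[THEN iffD1, rule_format]) (auto intro!: continuous_intros)
    then have V: "f ?V \<in> \<tau>" by (rule mem)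
    show ?thesis
    proof (cases "0 \<in> U")
      case True
      then have "inverse -` U = \<Union>{?V, {0}}" by auto
      then have "u U = sup (f ?V) (f {0})"
        using frame_hom_Sup[OF hom, of "{?V, {0}}"] by (simp add: u_def)
      then show ?thesis using subframe_sup[OF \<tau> V z] by simp
    next
      case False
      then have "inverse -` U = ?V" by auto
      then show ?thesis using V by (simp add: u_def)
    qed
  qed
  then show "u \<in> carrier (RL \<tau>)"
    using homu by (simp add: RL_def real_continuous_iff_open[OF \<tau>])
  have "lift_op (*) (lift_op (*) f f) u = f"
  proof (rule frame_hom_eqI_pieces[of _ _ f f f], goal_cases)
    case (6 a x y z)
    have "inverse -` {inverse x} = {x}" by auto
    then have "a \<le> u {inverse x}" using 6 by (simp add: u_def)
    then have "a \<le> lift_op (*) (lift_op (*) f f) u {x * x * inverse x}"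
      using 6 by (intro lift_op_value)
    moreover have "x * x * inverse x = x" by (cases "x = 0") auto
    ultimately show ?case
      using 6 by (intro exI[of _ x]) metis
  qed (auto intro!: frame_hom_lift_op hom homu)
  then show "(f \<otimes>\<^bsub>RL \<tau>\<^esub> f) \<otimes>\<^bsub>RL \<tau>\<^esub> u = f"
    by (simp add: RL_def)
qed

section \<open>Commutative von Neumann regular rings\<close>

text \<open>The elements fixed by multiplication with \<open>e\<close> form an ideal, so it suffices to look at
  generators.\<close>

lemma (in cring) genideal_local_identity:
  assumes e: "e \<in> carrier R" and S: "S \<subseteq> carrier R" and fixed: "\<And>s. s \<in> S \<Longrightarrow> s \<otimes> e = s"
    and x: "x \<in> Idl S"
  shows "x \<otimes> e = x"
proof -
  have "ideal {x \<in> carrier R. x \<otimes> e = x} R"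
  proof (rule idealI)
    show "subgroup {x \<in> carrier R. x \<otimes> e = x} (add_monoid R)"
    proof (rule add.subgroupI)
      have "\<zero> \<in> {x \<in> carrier R. x \<otimes> e = x}" using e by simp
      then show "{x \<in> carrier R. x \<otimes> e = x} \<noteq> {}" by blast
    qed (use e in \<open>auto simp: l_distr l_minus\<close>)
    fix a b assume "a \<in> {x \<in> carrier R. x \<otimes> e = x}" "b \<in> carrier R"
    then have "a \<otimes> e = a" "a \<in> carrier R" "b \<in> carrier R" by auto
    then show "b \<otimes> a \<in> {x \<in> carrier R. x \<otimes> e = x}" "a \<otimes> b \<in> {x \<in> carrier R. x \<otimes> e = x}"
      using e by (auto simp: m_assoc m_comm[of a b])
  qed (rule ring_axioms)
  then have "Idl S \<subseteq> {x \<in> carrier R. x \<otimes> e = x}"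
    using S fixed by (intro genideal_minimal) auto
  with x show ?thesis by auto
qed

text \<open>Suppose that \<open>e\<close> acts as an identity on the generators in \<open>S\<close>, and add a generator \<open>s\<close>.  The
  part \<open>t = s (1 - e)\<close> of \<open>s\<close> that \<open>e\<close> fails to reproduce is recovered from \<open>s\<close> by the factor \<open>t u\<close>,
  where \<open>u\<close> is a quasi-inverse of \<open>t\<close>: as \<open>e\<close> lies in the ideal generated by \<open>S\<close>, it is idempotent,
  and so \<open>s t u = t\<^sup>2 u = t\<close>.  Moreover \<open>t u\<close> annihilates \<open>S\<close>.  Hence \<open>e + t u\<close> acts as an identity on
  the larger set.\<close>

lemma (in cring) regular_finite_local_identity:
  assumes reg: "\<And>x. x \<in> carrier R \<Longrightarrow> \<exists>u\<in>carrier R. (x \<otimes> x) \<otimes> u = x"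
    and "finite S" "S \<subseteq> carrier R"
  shows "\<exists>e\<in>Idl S. \<forall>s\<in>S. s \<otimes> e = s"
  using assms(2,3)
proof (induction S rule: finite_induct)
  case empty
  have "\<zero> \<in> Idl {}"
    using genideal_ideal[of "{}"] by (meson additive_subgroup.zero_closed empty_subsetI ideal.axioms(1))
  then show ?case by auto
next
  case (insert s S)
  then obtain e where e: "e \<in> Idl S" "\<And>r. r \<in> S \<Longrightarrow> r \<otimes> e = r" by auto
  have s: "s \<in> carrier R" and S: "S \<subseteq> carrier R" using insert.prems by auto
  interpret I: ideal "Idl (insert s S)" R
    using insert.prems by (rule genideal_ideal)
  have sub: "insert s S \<subseteq> Idl (insert s S)"
    using insert.prems by (rule genideal_self)
  then have "Idl S \<subseteq> Idl (insert s S)"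
    by (intro genideal_minimal I.is_ideal) auto
  with e have eI: "e \<in> Idl (insert s S)" by auto
  then have ec: "e \<in> carrier R" by (rule I.a_Hcarr)
  define t where "t = s \<otimes> (\<one> \<ominus> e)"
  have t: "t \<in> carrier R" using s ec by (simp add: t_def)
  then obtain u where u: "u \<in> carrier R" "(t \<otimes> t) \<otimes> u = t" using reg by blast
  have "t \<in> Idl (insert s S)"
    using sub s ec by (auto simp: t_def intro: I.I_r_closed)
  then have "e \<oplus> t \<otimes> u \<in> Idl (insert s S)"
    using eI u by (intro I.a_closed I.I_r_closed)
  moreover have "r \<otimes> (e \<oplus> t \<otimes> u) = r" if "r \<in> S" for r
  proof -
    have r: "r \<in> carrier R" using that S by auto
    have "r \<otimes> (e \<oplus> t \<otimes> u) = r \<otimes> e \<oplus> (r \<ominus> r \<otimes> e) \<otimes> (s \<otimes> u)"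
      unfolding t_def using r s ec u(1) by algebra
    also have "\<dots> = r"
      using r s u(1) e(2)[OF that] by (simp add: r_neg a_minus_def)
    finally show ?thesis .
  qed
  moreover have "s \<otimes> (e \<oplus> t \<otimes> u) = s"
  proof -
    have ee: "e \<otimes> e = e"
      using genideal_local_identity[OF ec S e(2) e(1)] .
    have "s \<otimes> t \<otimes> u = s \<otimes> (s \<otimes> (\<one> \<ominus> e \<ominus> e \<oplus> e \<otimes> e)) \<otimes> u"
      unfolding ee t_def using s ec u(1) by algebra
    also have "\<dots> = (t \<otimes> t) \<otimes> u"
      unfolding t_def using s ec u(1) by algebra
    finally have "s \<otimes> t \<otimes> u = t" using u(2) by simp
    moreover have "s \<otimes> (e \<oplus> t \<otimes> u) = s \<otimes> e \<oplus> s \<otimes> t \<otimes> u"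
      using s ec t u(1) by algebra
    moreover have "s \<otimes> e \<oplus> t = s"
      unfolding t_def using s ec by algebra
    ultimately show ?thesis by simp
  qed
  ultimately show ?case by blast
qed

text \<open>With \<open>e\<close> a local identity for \<open>I\<close>, an element \<open>x = a (1 - e)\<close> of the ideal generated by
  \<open>1 - e\<close> that also lies in \<open>I\<close> satisfies \<open>x = x e = a (1 - e) e = 0\<close>.\<close>

lemma (in cring) regular_kasch:
  assumes reg: "\<And>x. x \<in> carrier R \<Longrightarrow> \<exists>u\<in>carrier R. (x \<otimes> x) \<otimes> u = x"
  shows "kasch natLeq R"
  unfolding kasch_def
proof (intro conjI allI impI)
  show "cring R" by (rule cring_axioms)
  fix I assume "ideal I R \<and> I \<noteq> carrier R \<and> gen R I <o natLeq"
  then have I: "ideal I R" and proper: "I \<noteq> carrier R" and small: "gen R I <o natLeq" by auto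
  interpret I: ideal I R by (rule I)
  obtain S where S: "S \<subseteq> carrier R" "Idl S = I" "gen R I = |S|"
    using gen_least[OF I] by (auto simp: generates_def)
  then have "finite S" using small by (simp add: finite_iff_ordLess_natLeq)
  then obtain e where e: "e \<in> I" "\<And>s. s \<in> S \<Longrightarrow> s \<otimes> e = s"
    using regular_finite_local_identity[OF reg] S by metis
  have ec: "e \<in> carrier R" using e(1) by (rule I.a_Hcarr)
  have fixed: "x \<otimes> e = x" if "x \<in> I" for x
    using genideal_local_identity[OF ec S(1) e(2)] that S(2) by simp
  define d where "d = \<one> \<ominus> e"
  have dc: "d \<in> carrier R" using ec by (simp add: d_def)
  have "d \<noteq> \<zero>"
  proof
    assume "d = \<zero>"
    have "\<one> = d \<oplus> e" unfolding d_def using ec by algebra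
    with \<open>d = \<zero>\<close> have "\<one> = e" using ec by simp
    then show False using I.one_imp_carrier e(1) proper by simp
  qed
  moreover have "d \<in> PIdl d"
    using dc by (rule cgenideal_self)
  ultimately have "PIdl d \<noteq> {\<zero>}" by auto
  moreover have J: "ideal (PIdl d) R"
    using dc by (rule cgenideal_ideal)
  moreover have "I \<inter> PIdl d = {\<zero>}"
  proof (intro subset_antisym subsetI)
    fix x assume x: "x \<in> I \<inter> PIdl d"
    then obtain a where a: "a \<in> carrier R" "x = a \<otimes> d" by (auto simp: cgenideal_def)
    have "x = x \<otimes> e" using fixed x by simp
    also have "\<dots> = a \<otimes> (e \<ominus> e \<otimes> e)"
      unfolding a(2) d_def using a(1) ec by algebra
    also have "\<dots> = \<zero>" using fixed[OF e(1)] a(1) ec by (simp add: a_minus_def r_neg)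
    finally show "x \<in> {\<zero>}" by simp
  next
    fix x assume "x \<in> {\<zero>}"
    then show "x \<in> I \<inter> PIdl d"
      using additive_subgroup.zero_closed[OF ideal.axioms(1)[OF J]] by simp
  qed
  ultimately show "\<not> essential_ideal R I"
    by (auto simp: essential_ideal_def)
qed

theorem theorem1:
  fixes \<tau> :: "'a::frame set"
  assumes "topoframe \<tau>"
    and "P_topoframe \<tau>"
  shows "kasch natLeq (RL \<tau>)"
proof -
  interpret cring "RL \<tau>"
    using assms(1) by (intro RL_cring) (simp add: topoframe_def)
  show ?thesis
    using RL_regular[OF assms(2)] by (rule regular_kasch)
qed

end
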